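(* Let $f$ be a Boolean function every minterm of which has at most two literals (equivalently, $f$ admits a DNF all of whose terms contain at most two literals). Then $\gamma(f) \geq l(f)/3$, where $l(f)$ is the size of a largest maxterm of $f$.
   Context: Let $f$ be a Boolean function on variables $V=\{x_1,\dots,x_n\}$. A literal is a variable $x$ or its negation $\overline{x}$, with $\overline{x}(\sigma)=1-x(\sigma)$. A minterm (maxterm) of $f$ is a minimal set of literals such that setting all its literals to $1$ (resp. $0$) forces $f$ to evaluate to $1$ (resp. $0$) regardless of the other variables. Each variable $x$ has a cost $c(x)\ge 0$ paid to read its value; $c(U)=\sum_{x\in U}c(x)$. An assignment $\sigma$ gives each variable a value in $\{0,1\}$; $\sigma_U$ is its restriction to $U\subseteq V$. A set $U$ is a proof of $f$ for $\sigma$ if the value of $f$ is determined by $\sigma_U$ and this holds for no proper subset of $U$. An evaluation algorithm $\mathbb{A}$ is a deterministic decision tree that adaptively reads variables until the set of variables read contains a proof for the current assignment. $c^f_{\mathbb{A}}(\sigma)$ is the total cost of the variables read by $\mathbb{A}$ on $\sigma$, and $c^f(\sigma)$ is the minimum cost of a proof of $f$ for $\sigma$. $\gamma^{\mathbb{A}}_c(f)$ is the infimum of all $\rho$ with $c^f_{\mathbb{A}}(\sigma)\le \rho\, c^f(\sigma)$ for every assignment $\sigma$; $\gamma^{\mathbb{A}}(f)=\sup_c \gamma^{\mathbb{A}}_c(f)$ over all nonnegative cost functions $c$; and $\gamma(f)=\inf_{\mathbb{A}}\gamma^{\mathbb{A}}(f)$ over all deterministic evaluation algorithms. *)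

theory Defs
  imports Complex_Main "HOL-Library.Extended_Nonnegative_Real"
begin

type_synonym 'v assignment = "'v \<Rightarrow> bool"
type_synonym 'v boolfun = "'v assignment \<Rightarrow> bool"

datatype 'v literal = Pos 'v | Neg 'v

fun lit_val :: "'v assignment \<Rightarrow> 'v literal \<Rightarrow> bool" where
  "lit_val \<sigma> (Pos x) = \<sigma> x"
| "lit_val \<sigma> (Neg x) = (\<not> \<sigma> x)"

text \<open>
  The first conjunct excludes sets containing both a variable and its negation, which cannot be
  set to a common value and would otherwise force every function vacuously.
\<close>

definition forces :: "'v boolfun \<Rightarrow> bool \<Rightarrow> 'v literal set \<Rightarrow> bool" where
  "forces f b L \<longleftrightarrow> (\<exists>\<sigma>. \<forall>l\<in>L. lit_val \<sigma> l = b) \<and>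
     (\<forall>\<sigma>. (\<forall>l\<in>L. lit_val \<sigma> l = b) \<longrightarrow> f \<sigma> = b)"

definition minterm :: "'v boolfun \<Rightarrow> 'v literal set \<Rightarrow> bool" where
  "minterm f L \<longleftrightarrow> forces f True L \<and> (\<forall>M. M \<subset> L \<longrightarrow> \<not> forces f True M)"

definition maxterm :: "'v boolfun \<Rightarrow> 'v literal set \<Rightarrow> bool" where
  "maxterm f L \<longleftrightarrow> forces f False L \<and> (\<forall>M. M \<subset> L \<longrightarrow> \<not> forces f False M)"

text \<open>
  The supremum is a maximum, except for the constantly true function, which has no maxterm and
  gets the value \<open>0\<close>.
\<close>

definition max_maxterm_size :: "('v::finite) boolfun \<Rightarrow> nat" where
  "max_maxterm_size f = Sup (card ` {L. maxterm f L})"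

definition determines :: "'v boolfun \<Rightarrow> 'v assignment \<Rightarrow> 'v set \<Rightarrow> bool" where
  "determines f \<sigma> U \<longleftrightarrow> (\<forall>\<tau>. (\<forall>x\<in>U. \<tau> x = \<sigma> x) \<longrightarrow> f \<tau> = f \<sigma>)"

definition is_proof :: "'v boolfun \<Rightarrow> 'v assignment \<Rightarrow> 'v set \<Rightarrow> bool" where
  "is_proof f \<sigma> U \<longleftrightarrow> determines f \<sigma> U \<and> (\<forall>W. W \<subset> U \<longrightarrow> \<not> determines f \<sigma> W)"

definition contains_proof :: "'v boolfun \<Rightarrow> 'v assignment \<Rightarrow> 'v set \<Rightarrow> bool" where
  "contains_proof f \<sigma> U \<longleftrightarrow> (\<exists>P\<subseteq>U. is_proof f \<sigma> P)"

text \<open>In \<open>Read x T0 T1\<close>, the tree continues with \<open>T1\<close> if \<open>x\<close> is true and with \<open>T0\<close> otherwise.\<close>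

datatype 'v dtree = Stop | Read 'v "'v dtree" "'v dtree"

fun reads :: "'v dtree \<Rightarrow> 'v assignment \<Rightarrow> 'v list" where
  "reads Stop \<sigma> = []"
| "reads (Read x T0 T1) \<sigma> = x # reads (if \<sigma> x then T1 else T0) \<sigma>"

text \<open>The second conjunct says that reading stops as soon as a proof has been read.\<close>

definition evaluates :: "'v dtree \<Rightarrow> 'v boolfun \<Rightarrow> bool" where
  "evaluates T f \<longleftrightarrow> (\<forall>\<sigma>. contains_proof f \<sigma> (set (reads T \<sigma>)) \<and>
     (\<forall>k<length (reads T \<sigma>). \<not> contains_proof f \<sigma> (set (take k (reads T \<sigma>)))))"

definition tree_cost :: "('v \<Rightarrow> real) \<Rightarrow> 'v dtree \<Rightarrow> 'v assignment \<Rightarrow> real" where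
  "tree_cost c T \<sigma> = (\<Sum>x\<in>set (reads T \<sigma>). c x)"

definition proof_cost :: "('v::finite \<Rightarrow> real) \<Rightarrow> 'v boolfun \<Rightarrow> 'v assignment \<Rightarrow> real" where
  "proof_cost c f \<sigma> = Min ((\<lambda>U. \<Sum>x\<in>U. c x) ` {U. is_proof f \<sigma> U})"

text \<open>The ratio is \<open>\<infinity>\<close> if no finite \<open>\<rho>\<close> is admissible, since \<open>Inf {} = \<infinity>\<close>.\<close>

definition tree_ratio :: "('v::finite \<Rightarrow> real) \<Rightarrow> 'v dtree \<Rightarrow> 'v boolfun \<Rightarrow> ennreal" where
  "tree_ratio c T f =
     Inf {ennreal \<rho> | \<rho>. 0 \<le> \<rho> \<and> (\<forall>\<sigma>. tree_cost c T \<sigma> \<le> \<rho> * proof_cost c f \<sigma>)}"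

definition cost_functions :: "('v \<Rightarrow> real) set" where
  "cost_functions = {c. \<forall>x. 0 \<le> c x}"

text \<open>
  The costs are known in advance, so an algorithm is a decision tree that may depend on the cost
  function. Were a single tree required to work for all cost functions, the cost function that
  charges only for the variable at its root would make the ratio infinite as soon as some
  assignment has a proof that avoids this variable.
\<close>

definition eval_algorithm :: "(('v \<Rightarrow> real) \<Rightarrow> 'v dtree) \<Rightarrow> 'v boolfun \<Rightarrow> bool" where
  "eval_algorithm A f \<longleftrightarrow> (\<forall>c\<in>cost_functions. evaluates (A c) f)"

definition algorithm_ratio ::
    "(('v::finite \<Rightarrow> real) \<Rightarrow> 'v dtree) \<Rightarrow> 'v boolfun \<Rightarrow> ennreal" where
  "algorithm_ratio A f = (SUP c\<in>cost_functions. tree_ratio c (A c) f)"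

definition extremal_ratio :: "('v::finite) boolfun \<Rightarrow> ennreal" where
  "extremal_ratio f = (INF A\<in>{A. eval_algorithm A f}. algorithm_ratio A f)"

text \<open>A lower bound on \<open>extremal_ratio\<close> therefore also holds for cost-oblivious trees.\<close>

lemma extremal_ratio_le_oblivious:
  "extremal_ratio f \<le> (INF T\<in>{T. evaluates T f}. SUP c\<in>cost_functions. tree_ratio c T f)"
proof (rule INF_greatest)
  fix T assume "T \<in> {T. evaluates T f}"
  then have "(\<lambda>_. T) \<in> {A. eval_algorithm A f}"
    by (simp add: eval_algorithm_def)
  then have "extremal_ratio f \<le> algorithm_ratio (\<lambda>_. T) f"
    unfolding extremal_ratio_def by (rule INF_lower)
  then show "extremal_ratio f \<le> (SUP c\<in>cost_functions. tree_ratio c T f)"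
    by (simp add: algorithm_ratio_def)
qed

end

theory Submission
  imports Defs
begin

text \<open>
  Let \<open>L\<close> be a maxterm, falsified by \<open>a\<close>. By minimality every literal \<open>i\<close> of \<open>L\<close> lies in a minterm
  that contains no other literal of \<open>L\<close>; its possible second literal, the partner of \<open>i\<close>, is either
  the negation of another literal of \<open>L\<close> or a literal on a variable outside \<open>L\<close>. Sending \<open>i\<close> to its
  partner in the former case gives a partial function on \<open>L\<close> without fixed points, so \<open>L\<close> has a
  proper 3-colouring, in which moreover the literals with an outside partner can be precoloured
  according to the sign of the partner. Within one colour class \<open>S\<close>, all partners are satisfied
  by a single assignment that falsifies \<open>L\<close>. Fixing this assignment off \<open>S\<close> leaves the
  disjunction of \<open>S\<close>: if only \<open>S\<close> is charged, then answering \<open>0\<close> until the last variable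
  of \<open>S\<close> is read costs \<open>card S\<close>, against a proof of cost \<open>1\<close>.
\<close>

section \<open>Three-colouring the graph of a partial function\<close>

text \<open>Remove a vertex \<open>v\<close> with at most one preimage in \<open>B\<close>, colour
  the rest, and give \<open>v\<close> a colour different from those of its preimage and of
  \<open>h v\<close>.\<close>

lemma functional_graph_3_colouring:
  fixes h :: "'a \<Rightarrow> 'a" and c0 :: "'a \<Rightarrow> nat"
  assumes "finite B" "\<forall>x\<in>B. h x \<noteq> x" "\<forall>x. c0 x < 3"
  shows "\<exists>c. (\<forall>x. c x < 3) \<and> (\<forall>x. x \<notin> B \<longrightarrow> c x = c0 x) \<and> (\<forall>x\<in>B. c x \<noteq> c (h x))"
  using assms
proof (induction B rule: finite_psubset_induct)
  case (psubset B)
  show ?case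
  proof (cases "B = {}")
    case True
    with psubset.prems show ?thesis by blast
  next
    case False
    have "\<exists>v\<in>B. \<exists>u. \<forall>x\<in>B. h x = v \<longrightarrow> x = u"
    proof (cases "B \<subseteq> h ` B")
      case True
      then have "card (h ` B) = card B"
        using psubset.hyps by (meson card_image_le card_mono finite_imageI le_antisym)
      then have "inj_on h B"
        using psubset.hyps by (simp add: eq_card_imp_inj_on)
      then show ?thesis
        using \<open>B \<noteq> {}\<close> True unfolding inj_on_def by blast
    next
      case False
      then obtain v where "v \<in> B" "v \<notin> h ` B" by blast
      then have "\<forall>x\<in>B. h x = v \<longrightarrow> x = v" by blast
      with \<open>v \<in> B\<close> show ?thesis by blast
    qed
    then obtain v u where v: "v \<in> B" and u: "\<And>x. x \<in> B \<Longrightarrow> h x = v \<Longrightarrow> x = u"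
      by blast
    have "B - {v} \<subset> B" using v by blast
    with psubset obtain c where c: "\<forall>x. c x < 3" "\<forall>x. x \<notin> B - {v} \<longrightarrow> c x = c0 x"
      "\<forall>x\<in>B - {v}. c x \<noteq> c (h x)"
      by (metis (no_types, lifting) DiffD1)
    have "\<exists>k::nat. k < 3 \<and> k \<noteq> c u \<and> k \<noteq> c (h v)"
      by presburger
    then obtain k :: nat where k: "k < 3" "k \<noteq> c u" "k \<noteq> c (h v)"
      by blast
    show ?thesis
    proof (intro exI[of _ "c(v := k)"] conjI)
      show "\<forall>x. (c(v := k)) x < 3" using c(1) k(1) by simp
      show "\<forall>x. x \<notin> B \<longrightarrow> (c(v := k)) x = c0 x" using c(2) v by auto
      show "\<forall>x\<in>B. (c(v := k)) x \<noteq> (c(v := k)) (h x)"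
      proof
        fix x assume "x \<in> B"
        then show "(c(v := k)) x \<noteq> (c(v := k)) (h x)"
          using c(3) k u psubset.prems(1) by (cases "x = v") auto
      qed
    qed
  qed
qed

section \<open>Decision trees against sensitive sets\<close>

lemma exists_minimal_subset:
  assumes "finite U" "Q U"
  shows "\<exists>P\<subseteq>U. Q P \<and> (\<forall>W. W \<subset> P \<longrightarrow> \<not> Q W)"
  using assms
proof (induction U rule: finite_psubset_induct)
  case (psubset U)
  then show ?case
    by (cases "\<exists>W. W \<subset> U \<and> Q W") (meson psubset_imp_subset subset_trans, blast)
qed

text \<open>Take the variable of \<open>S\<close> whose first reading comes last: flipping it leaves
  the path unchanged until all of \<open>S\<close> has been read.\<close>

lemma reads_flip_last:
  assumes "S \<noteq> {}" "S \<subseteq> set (reads T \<sigma>)"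
  shows "\<exists>x\<in>S. S \<subseteq> set (reads T (\<sigma>(x := \<not> \<sigma> x)))"
  using assms
proof (induction T arbitrary: S)
  case Stop
  then show ?case by simp
next
  case (Read y T0 T1)
  show ?case
  proof (cases "S = {y}")
    case True
    then show ?thesis by simp
  next
    case False
    then have "S - {y} \<noteq> {}"
      using Read.prems(1) by blast
    moreover have "S - {y} \<subseteq> set (reads (if \<sigma> y then T1 else T0) \<sigma>)"
      using Read.prems(2) by auto
    ultimately have "\<exists>x\<in>S - {y}. S - {y} \<subseteq> set (reads (if \<sigma> y then T1 else T0) (\<sigma>(x := \<not> \<sigma> x)))"
      using Read.IH(1)[of "S - {y}"] Read.IH(2)[of "S - {y}"]
      by (cases "\<sigma> y") (simp_all only: if_True if_False simp_thms)
    then obtain x where x: "x \<in> S - {y}"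
      "S - {y} \<subseteq> set (reads (if \<sigma> y then T1 else T0) (\<sigma>(x := \<not> \<sigma> x)))"
      by blast
    \<comment> \<open>As \<open>x\<close> differs from \<open>y\<close>, the flip keeps the branch
      taken at the root.\<close>
    then have "S \<subseteq> set (reads (Read y T0 T1) (\<sigma>(x := \<not> \<sigma> x)))"
      by auto
    then show ?thesis using x(1) by blast
  qed
qed

lemma proof_cost_le:
  fixes f :: "('v::finite) boolfun"
  assumes "determines f \<sigma> U" "\<And>x. 0 \<le> c x"
  shows "proof_cost c f \<sigma> \<le> sum c U"
proof -
  obtain P where P: "P \<subseteq> U" "is_proof f \<sigma> P"
    using exists_minimal_subset[of U "determines f \<sigma>"] assms(1) unfolding is_proof_def by auto
  have "proof_cost c f \<sigma> \<le> sum c P"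
    unfolding proof_cost_def using P(2) by (intro Min_le) auto
  also have "\<dots> \<le> sum c U"
    using P(1) assms(2) by (intro sum_mono2) auto
  finally show ?thesis .
qed

text \<open>While only \<open>S\<close> varies, \<open>f\<close> tests whether the assignment
  differs from \<sigma>. On \<sigma> the tree must read all of \<open>S\<close>; flipping the last
  variable read keeps this cost but leaves a proof of cost at most 1.\<close>

lemma tree_ratio_ge_sensitive_set:
  fixes f :: "('v::finite) boolfun"
  assumes "evaluates T f"
    and sens: "\<And>x \<tau>. x \<in> S \<Longrightarrow> \<forall>z. z \<notin> S \<longrightarrow> \<tau> z = \<sigma> z \<Longrightarrow> \<tau> x \<noteq> \<sigma> x \<Longrightarrow> f \<tau> \<noteq> f \<sigma>"
  shows "ennreal (real (card S)) \<le> tree_ratio (indicator S) T f"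
proof (cases "S = {}")
  case True
  then show ?thesis by simp
next
  case False
  obtain P where P: "P \<subseteq> set (reads T \<sigma>)" "determines f \<sigma> P"
    using assms(1)[unfolded evaluates_def, rule_format, of \<sigma>]
    unfolding contains_proof_def is_proof_def by auto
  have "S \<subseteq> P"
  proof
    fix x assume "x \<in> S"
    then have "f (\<sigma>(x := \<not> \<sigma> x)) \<noteq> f \<sigma>"
      by (intro sens) auto
    moreover have "f (\<sigma>(x := \<not> \<sigma> x)) = f \<sigma>" if "x \<notin> P"
      using P(2)[unfolded determines_def, rule_format, of "\<sigma>(x := \<not> \<sigma> x)"] that
      by (metis fun_upd_other)
    ultimately show "x \<in> P" by blast
  qed
  with P(1) False obtain x where x: "x \<in> S" "S \<subseteq> set (reads T (\<sigma>(x := \<not> \<sigma> x)))"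
    using reads_flip_last[of S T \<sigma>] by blast
  define \<tau> where "\<tau> = \<sigma>(x := \<not> \<sigma> x)"
  \<comment> \<open>The flipped \<open>x\<close> and the free variables off \<open>S\<close> fix the
    value, whatever the rest of \<open>S\<close> is.\<close>
  have "f \<rho> = (\<not> f \<sigma>)" if "\<forall>z\<in>insert x (- S). \<rho> z = \<tau> z" for \<rho>
  proof -
    have "f \<rho> \<noteq> f \<sigma>"
      using that x(1) by (intro sens[of x]) (auto simp: \<tau>_def)
    then show ?thesis by blast
  qed
  then have "determines f \<tau> (insert x (- S))"
    unfolding determines_def by simp
  then have "proof_cost (indicator S) f \<tau> \<le> sum (indicator S) (insert x (- S))"
    by (rule proof_cost_le) simp
  also have "\<dots> = 1"
    using x(1) by (subst sum.insert) auto
  finally have cheap: "proof_cost (indicator S) f \<tau> \<le> 1" .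
  have "tree_cost (indicator S) T \<tau> = real (card (set (reads T \<tau>) \<inter> S))"
    unfolding tree_cost_def by (simp add: indicator_def sum.If_cases Int_def)
  also have "set (reads T \<tau>) \<inter> S = S"
    using x(2) unfolding \<tau>_def by blast
  finally have dear: "tree_cost (indicator S) T \<tau> = real (card S)" .
  show ?thesis
    unfolding tree_ratio_def
  proof (rule Inf_greatest, clarify)
    fix \<rho> :: real
    assume \<rho>: "0 \<le> \<rho>"
      "\<forall>\<sigma>. tree_cost (indicator S) T \<sigma> \<le> \<rho> * proof_cost (indicator S) f \<sigma>"
    have "real (card S) \<le> \<rho> * proof_cost (indicator S) f \<tau>"
      using \<rho>(2)[rule_format, of \<tau>] dear by simp
    also have "\<dots> \<le> \<rho>"
      using cheap \<rho>(1) by (simp add: mult_left_le)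
    finally show "ennreal (real (card S)) \<le> ennreal \<rho>"
      by (rule ennreal_leI)
  qed
qed

text \<open>The cost function \<open>indicator S\<close> does not depend on the algorithm, so it can
  be used against all of them.\<close>

lemma extremal_ratio_ge_sensitive_set:
  fixes f :: "('v::finite) boolfun"
  assumes "\<And>x \<tau>. x \<in> S \<Longrightarrow> \<forall>z. z \<notin> S \<longrightarrow> \<tau> z = \<sigma> z \<Longrightarrow> \<tau> x \<noteq> \<sigma> x \<Longrightarrow> f \<tau> \<noteq> f \<sigma>"
  shows "ennreal (real (card S)) \<le> extremal_ratio f"
  unfolding extremal_ratio_def
proof (rule INF_greatest)
  fix A assume "A \<in> {A. eval_algorithm A f}"
  moreover have c: "(indicator S :: 'v \<Rightarrow> real) \<in> cost_functions"
    by (simp add: cost_functions_def)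
  ultimately have "evaluates (A (indicator S)) f"
    by (auto simp: eval_algorithm_def)
  then have "ennreal (real (card S)) \<le> tree_ratio (indicator S) (A (indicator S)) f"
    using assms by (rule tree_ratio_ge_sensitive_set)
  also have "\<dots> \<le> algorithm_ratio A f"
    unfolding algorithm_ratio_def using c by (rule SUP_upper)
  finally show "ennreal (real (card S)) \<le> algorithm_ratio A f" .
qed

section \<open>Literals, minterms and partners\<close>

fun lit_var :: "'v literal \<Rightarrow> 'v" where
  "lit_var (Pos x) = x"
| "lit_var (Neg x) = x"

lemma lit_val_cong: "\<tau> (lit_var l) = \<sigma> (lit_var l) \<Longrightarrow> lit_val \<tau> l = lit_val \<sigma> l"
  by (cases l) auto

lemma lit_val_flip: "\<tau> (lit_var l) \<noteq> \<sigma> (lit_var l) \<Longrightarrow> lit_val \<tau> l = (\<not> lit_val \<sigma> l)"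
  by (cases l) auto

lemma literal_eqI: "lit_var l = lit_var m \<Longrightarrow> lit_val \<sigma> l = lit_val \<sigma> m \<Longrightarrow> l = m"
  by (cases l; cases m) auto

lemma finite_literals: "finite (L :: ('v::finite) literal set)"
proof (rule finite_subset)
  show "L \<subseteq> range Pos \<union> range Neg"
    by (metis UnI1 UnI2 lit_var.cases rangeI subsetI)
qed simp

text \<open>The set of all literals true at \<sigma> is satisfied by \<sigma> alone, so it forces
  \<open>f\<close> to be true and can be shrunk to a minterm.\<close>

lemma exists_minterm_at:
  fixes f :: "('v::finite) boolfun"
  assumes "f \<sigma>"
  shows "\<exists>M. minterm f M \<and> (\<forall>l\<in>M. lit_val \<sigma> l)"
proof -
  define L where "L = {l. lit_val \<sigma> l}"
  have "\<tau> = \<sigma>" if "\<forall>l\<in>L. lit_val \<tau> l" for \<tau>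
  proof
    fix x
    show "\<tau> x = \<sigma> x"
      using that[rule_format, of "Pos x"] that[rule_format, of "Neg x"] by (auto simp: L_def)
  qed
  then have "forces f True L"
    unfolding forces_def using assms by (auto simp: L_def)
  then obtain M where "M \<subseteq> L" "minterm f M"
    using exists_minimal_subset[OF finite_literals, of "forces f True" L]
    unfolding minterm_def by auto
  then show ?thesis
    unfolding L_def by blast
qed

text \<open>The case \<open>y = x\<close> of the conclusion encodes a minterm with a single literal.\<close>

lemma maxterm_partner:
  fixes f :: "('v::finite) boolfun"
  assumes card2: "\<And>M. minterm f M \<Longrightarrow> card M \<le> 2"
    and L: "maxterm f L" and a: "\<forall>l\<in>L. \<not> lit_val a l" and i: "i \<in> L"
  defines "x \<equiv> lit_var i"
  shows "\<exists>y v. (\<forall>\<tau>. \<tau> x \<noteq> a x \<longrightarrow> \<tau> y = v \<longrightarrow> f \<tau>) \<and>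
    (y = x \<longrightarrow> v = (\<not> a x)) \<and> (y \<in> lit_var ` L \<longrightarrow> y \<noteq> x \<longrightarrow> v = a y)"
proof -
  have "\<not> forces f False (L - {i})"
    using L i unfolding maxterm_def by blast
  then obtain \<sigma> where \<sigma>: "\<forall>l\<in>L - {i}. \<not> lit_val \<sigma> l" "f \<sigma>"
    using a unfolding forces_def by auto
  then obtain M where M: "minterm f M" "\<forall>l\<in>M. lit_val \<sigma> l"
    using exists_minterm_at[of f \<sigma>] by blast
  have fM: "f \<tau>" if "\<forall>l\<in>M. lit_val \<tau> l" for \<tau>
    using M(1) that unfolding minterm_def forces_def by simp
  have "i \<in> M"
  proof (rule ccontr)
    assume "i \<notin> M"
    \<comment> \<open>Were \<open>i\<close> not in \<open>M\<close>, this mixture would falsify all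
      of \<open>L\<close> and still satisfy \<open>M\<close>: a literal of \<open>M\<close> on a
      variable of \<open>L\<close> would be the negation of a literal of \<open>L\<close>, hence
      true under \<open>a\<close>.\<close>
    define \<tau> where "\<tau> z = (if z \<in> lit_var ` L then a z else \<sigma> z)" for z
    have "\<forall>l\<in>L. \<not> lit_val \<tau> l"
      using a lit_val_cong[of \<tau> _ a] by (simp add: \<tau>_def)
    then have "\<not> f \<tau>"
      using L unfolding maxterm_def forces_def by simp
    moreover have "lit_val \<tau> m" if m: "m \<in> M" for m
    proof (cases "lit_var m \<in> lit_var ` L")
      case True
      then obtain l where l: "l \<in> L" "lit_var m = lit_var l" by blast
      have "m \<notin> L" using m M(2) \<sigma>(1) \<open>i \<notin> M\<close> by blast
      then have "lit_val a m"
        using l a literal_eqI[of m l a] by auto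
      then show ?thesis using True lit_val_cong[of \<tau> m a] by (simp add: \<tau>_def)
    next
      case False
      then show ?thesis using m M(2) lit_val_cong[of \<tau> m \<sigma>] by (simp add: \<tau>_def)
    qed
    ultimately show False using fM[of \<tau>] by blast
  qed
  have ix: "lit_val \<tau> i \<longleftrightarrow> \<tau> x \<noteq> a x" for \<tau>
    using a i lit_val_cong[of \<tau> i a] lit_val_flip[of \<tau> i a] unfolding x_def by blast
  have \<sigma>x: "\<sigma> x \<noteq> a x"
    using M(2) \<open>i \<in> M\<close> ix[of \<sigma>] by blast
  show ?thesis
  proof (cases "M = {i}")
    case True
    then show ?thesis
      using fM ix by (intro exI[of _ x] exI[of _ "\<not> a x"]) auto
  next
    case False
    have "card (M - {i}) \<le> 1"
      using card2[OF M(1)] \<open>i \<in> M\<close> finite_literals[of M] by simp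
    moreover from False obtain m where m: "m \<in> M" "m \<noteq> i"
      using \<open>i \<in> M\<close> by blast
    ultimately have Mm: "M = {i, m}"
      using \<open>i \<in> M\<close> finite_literals[of "M - {i}"] card_le_Suc0_iff_eq[of "M - {i}"] by auto
    have \<sigma>m: "lit_val \<sigma> m" using m M(2) by blast
    show ?thesis
    proof (intro exI[of _ "lit_var m"] exI[of _ "\<sigma> (lit_var m)"] conjI allI impI)
      fix \<tau> assume "\<tau> x \<noteq> a x" "\<tau> (lit_var m) = \<sigma> (lit_var m)"
      then show "f \<tau>"
        using fM[of \<tau>] Mm ix[of \<tau>] \<sigma>m lit_val_cong[of \<tau> m \<sigma>] by blast
    next
      assume "lit_var m = x"
      then show "\<sigma> (lit_var m) = (\<not> a x)" using \<sigma>x by simp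
    next
      assume "lit_var m \<in> lit_var ` L" "lit_var m \<noteq> x"
      then obtain l where l: "l \<in> L" "lit_var m = lit_var l" "l \<noteq> i"
        unfolding x_def by blast
      \<comment> \<open>Both assignments falsify \<open>l\<close>, so they agree on its
        variable.\<close>
      then have "\<not> lit_val \<sigma> l" "\<not> lit_val a l"
        using \<sigma>(1) a by blast+
      then show "\<sigma> (lit_var m) = a (lit_var m)"
        using l(2) lit_val_flip[of \<sigma> l a] by metis
    qed
  qed
qed

section \<open>Colour classes of a maxterm as sensitive sets\<close>

lemma maxterm_third_le_extremal_ratio:
  fixes f :: "('v::finite) boolfun"
  assumes card2: "\<And>M. minterm f M \<Longrightarrow> card M \<le> 2" and L: "maxterm f L"
  shows "ennreal (real (card L) / 3) \<le> extremal_ratio f"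
proof -
  obtain a where a: "\<forall>l\<in>L. \<not> lit_val a l"
    using L unfolding maxterm_def forces_def by auto
  define X where "X = lit_var ` L"
  have "inj_on lit_var L"
    using a literal_eqI[of _ _ a] by (intro inj_onI) blast
  then have card_X: "card X = card L"
    unfolding X_def by (rule card_image)
  have f_False: "\<not> f \<tau>" if "\<forall>x\<in>X. \<tau> x = a x" for \<tau>
  proof -
    have "\<forall>l\<in>L. \<not> lit_val \<tau> l"
      using a that lit_val_cong[of \<tau> _ a] by (simp add: X_def)
    then show ?thesis
      using L unfolding maxterm_def forces_def by simp
  qed
  have "\<forall>x\<in>X. \<exists>y v. (\<forall>\<tau>. \<tau> x \<noteq> a x \<longrightarrow> \<tau> y = v \<longrightarrow> f \<tau>) \<and>
      (y = x \<longrightarrow> v = (\<not> a x)) \<and> (y \<in> X \<longrightarrow> y \<noteq> x \<longrightarrow> v = a y)"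
    unfolding X_def using maxterm_partner[OF card2 L a] by blast
  then obtain h v where hv: "\<forall>x\<in>X. (\<forall>\<tau>. \<tau> x \<noteq> a x \<longrightarrow> \<tau> (h x) = v x \<longrightarrow> f \<tau>) \<and>
      (h x = x \<longrightarrow> v x = (\<not> a x)) \<and> (h x \<in> X \<longrightarrow> h x \<noteq> x \<longrightarrow> v x = a (h x))"
    unfolding bchoice_iff by (elim exE)
  define B where "B = {x \<in> X. h x \<in> X \<and> h x \<noteq> x}"
  have "\<forall>x\<in>B. h x \<noteq> x" "\<forall>x. (if v x then 1 else 0 :: nat) < 3"
    by (simp_all add: B_def)
  \<comment> \<open>Off \<open>B\<close> the colour is prescribed: 1 or 0 according to the value
    \<open>v x\<close> wanted from the partner.\<close>
  from functional_graph_3_colouring[OF finite this] obtain c :: "'v \<Rightarrow> nat" where c: "\<And>x. c x < 3"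
    "\<And>x. x \<notin> B \<Longrightarrow> c x = (if v x then 1 else 0)" "\<And>x. x \<in> B \<Longrightarrow> c x \<noteq> c (h x)"
    by blast
  define S where "S k = {x \<in> X. c x = k}" for k
  have S_le: "ennreal (real (card (S k))) \<le> extremal_ratio f" for k
  proof (rule extremal_ratio_ge_sensitive_set)
    \<comment> \<open>Off \<open>X\<close> every variable gets the value that the elements of colour
      \<open>k\<close> want from partners there; for \<open>k = 2\<close> no element has such a
      partner.\<close>
    let ?\<sigma> = "\<lambda>z. if z \<in> X then a z else k = 1"
    fix x \<tau>
    assume x: "x \<in> S k" and \<tau>: "\<forall>z. z \<notin> S k \<longrightarrow> \<tau> z = ?\<sigma> z" "\<tau> x \<noteq> ?\<sigma> x"
    have xX: "x \<in> X" and cx: "c x = k" using x by (auto simp: S_def)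
    have \<tau>x: "\<tau> x \<noteq> a x" using \<tau>(2) xX by simp
    have "\<tau> (h x) = v x"
    proof (cases "h x = x")
      case True
      then show ?thesis using hv xX \<tau>x by simp
    next
      case False
      show ?thesis
      proof (cases "h x \<in> X")
        case True
        \<comment> \<open>The partner lies in another class, so it keeps its value under
          \<open>a\<close>, which is \<open>v x\<close>.\<close>
        then have "c (h x) \<noteq> k"
          using c(3)[of x] cx xX False by (auto simp: B_def)
        then show ?thesis
          using \<tau>(1) True False hv xX by (simp add: S_def)
      next
        case False
        then have "c x = (if v x then 1 else 0)"
          using c(2) by (simp add: B_def)
        then have "v x = (k = 1)"
          using cx by auto
        then show ?thesis
          using \<tau>(1) False by (simp add: S_def)
      qed
    qed
    then have "f \<tau>" using bspec[OF hv xX] \<tau>x by simp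
    moreover have "\<not> f ?\<sigma>" by (rule f_False) simp
    ultimately show "f \<tau> \<noteq> f ?\<sigma>" by simp
  qed
  have "X = (\<Union>k<3. S k)"
    using c(1) by (auto simp: S_def)
  then have "card L \<le> (\<Sum>k<3. card (S k))"
    using card_UN_le[of "{..<3::nat}" S] card_X by simp
  then have "card L \<le> card (S 0) + card (S 1) + card (S 2)"
    by (simp add: numeral_3_eq_3 numeral_2_eq_2)
  then have "card L \<le> 3 * card (S 0) \<or> card L \<le> 3 * card (S 1) \<or> card L \<le> 3 * card (S 2)"
    by linarith
  then obtain k where "card L \<le> 3 * card (S k)"
    by blast
  then have "real (card L) / 3 \<le> real (card (S k))"
    by simp
  then have "ennreal (real (card L) / 3) \<le> ennreal (real (card (S k)))"
    by (rule ennreal_leI)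
  then show ?thesis
    using S_le order_trans by blast
qed

theorem theorem1:
  fixes f :: "('v::finite) boolfun"
  assumes "\<And>L. minterm f L \<Longrightarrow> card L \<le> 2"
  shows "extremal_ratio f \<ge> ennreal (real (max_maxterm_size f) / 3)"
proof (cases "\<exists>L. maxterm f L")
  case False
  then show ?thesis by (simp add: max_maxterm_size_def)
next
  case True
  then have "card ` {L. maxterm f L} \<noteq> {}" by blast
  moreover have "finite (card ` {L. maxterm f L})"
    using finite_subset[OF _ finite_Pow_iff[THEN iffD2, OF finite_literals[of UNIV]], of "{L. maxterm f L}"]
    by simp
  \<comment> \<open>A finite nonempty set of naturals attains its supremum.\<close>
  ultimately have "max_maxterm_size f \<in> card ` {L. maxterm f L}"
    unfolding max_maxterm_size_def by (simp add: Sup_nat_def)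
  then obtain L where "maxterm f L" "max_maxterm_size f = card L"
    by blast
  then show ?thesis
    using maxterm_third_le_extremal_ratio[OF assms] by simp
qed

end
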